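(* Let $(\mathbf{x}_t,\mathbf{z}_t,\mathbf{y}_t)_{t\ge1}$ be generated by OADM with $\eta=0$ and time-varying penalty (defined in the context), let assumptions (a)–(e) of the context hold, and assume that $A$ is a square invertible matrix; let $\lambda_{\min}^{A}>0$ be the smallest eigenvalue of $AA^T$ and $\lambda_{\max}^{B}>0$ the largest eigenvalue of $B^TB$. Assume that $g$ is $\beta_2$-strongly convex, i.e. $g(\mathbf{z}')\ge g(\mathbf{z})+\langle g'(\mathbf{z}),\mathbf{z}'-\mathbf{z}\rangle+\frac{\beta_2}{2}\|\mathbf{z}'-\mathbf{z}\|_2^2$ for all $\mathbf{z},\mathbf{z}'$ and $g'(\mathbf{z})\in\partial g(\mathbf{z})$, with $\beta_2>0$. Let $\hat{\mathbf{x}}_t$ be defined by $A\hat{\mathbf{x}}_t+B\mathbf{z}_t=\mathbf{c}$. Setting $\rho_t=\beta_2t/\lambda_{\max}^{B}$, for every $T\ge1$, $$R_2(T)\le\frac{G_f^2\lambda_{\max}^{B}}{2\lambda_{\min}^{A}\beta_2}\log(T+1)+\beta_2D_{\mathbf{z}}^2,\qquad R^c(T)\le\lambda_{\max}^{B}D_{\mathbf{z}}^2+\frac{2F\lambda_{\max}^{B}}{\beta_2}\log(T+1),$$ where $$R_2(T)=\sum_{t=1}^T\big(f_t(\hat{\mathbf{x}}_t)+g(\mathbf{z}_t)\big)-\min_{\mathbf{z}\in\mathcal{Z},\,A\mathbf{x}+B\mathbf{z}=\mathbf{c}}\sum_{t=1}^T\big(f_t(\mathbf{x})+g(\mathbf{z})\big),$$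 $$R^c(T)=\sum_{t=1}^T\Big(\|A\mathbf{x}_{t+1}+B\mathbf{z}_{t+1}-\mathbf{c}\|_2^2+\|B\mathbf{z}_{t+1}-B\mathbf{z}_t\|_2^2\Big).$$
   Context: Setting: $\mathcal{Z}\subset\mathbb{R}^{n_2}$ is a convex set, $A\in\mathbb{R}^{m\times n_1}$, $B\in\mathbb{R}^{m\times n_2}$, $\mathbf{c}\in\mathbb{R}^m$ are fixed, $f_1,f_2,\dots:\mathbb{R}^{n_1}\to\mathbb{R}$ are convex and $g:\mathbb{R}^{n_2}\to\mathbb{R}\cup\{+\infty\}$ is closed, proper, convex. A pair $(\mathbf{x}^*,\mathbf{z}^* )\in\mathbb{R}^{n_1}\times\mathcal{Z}$ is feasible if $A\mathbf{x}^*+B\mathbf{z}^*=\mathbf{c}$; feasible pairs exist. OADM with $\eta=0$ and time-varying $\rho_t>0$: in round $t\ge1$ the parameter $\rho_{t+1}$ is used, $$\mathbf{x}_{t+1}\in\operatorname{argmin}_{\mathbf{x}\in\mathbb{R}^{n_1}}\{f_t(\mathbf{x})+\langle\mathbf{y}_t,A\mathbf{x}+B\mathbf{z}_t-\mathbf{c}\rangle+\tfrac{\rho_{t+1}}{2}\|A\mathbf{x}+B\mathbf{z}_t-\mathbf{c}\|_2^2\},$$ $$\mathbf{z}_{t+1}\in\operatorname{argmin}_{\mathbf{z}\in\mathcal{Z}}\{g(\mathbf{z})+\langle\mathbf{y}_t,A\mathbf{x}_{t+1}+B\mathbf{z}-\mathbf{c}\rangle+\tfrac{\rho_{t+1}}{2}\|A\mathbf{x}_{t+1}+B\mathbf{z}-\mathbf{c}\|_2^2\},$$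 $$\mathbf{y}_{t+1}=\mathbf{y}_t+\rho_{t+1}(A\mathbf{x}_{t+1}+B\mathbf{z}_{t+1}-\mathbf{c}),$$ the minimizers being assumed to exist. Assumptions. (a) $\|f_t'(\mathbf{x})\|_2\le G_f$ for every $t$, every $\mathbf{x}$ and every $f_t'(\mathbf{x})\in\partial f_t(\mathbf{x})$. (b) $B_\phi(\mathbf{u},\mathbf{v})=\phi(\mathbf{u})-\phi(\mathbf{v})-\langle\nabla\phi(\mathbf{v}),\mathbf{u}-\mathbf{v}\rangle$ is a Bregman divergence with $B_\phi(\mathbf{u},\mathbf{v})\ge\frac{\alpha}{2}\|\mathbf{u}-\mathbf{v}\|_2^2$, $\alpha>0$ (it does not enter the updates because $\eta=0$). (c) $\mathbf{x}_1=\mathbf{0}$, $\mathbf{y}_1=\mathbf{0}$, $\mathbf{z}_1=\mathbf{0}\in\mathcal{Z}$, and every feasible pair $(\mathbf{x}^*,\mathbf{z}^* )$ satisfies $B_\phi(\mathbf{x}^*,\mathbf{x}_1)\le D_{\mathbf{x}}^2$ and $\|\mathbf{z}^*-\mathbf{z}_1\|_2\le D_{\mathbf{z}}$. (d) $g(\mathbf{z}_1)=0$ and $g(\mathbf{z})\ge0$ for all $\mathbf{z}$. (e) There is a constant $F>0$ such that $f_t(\mathbf{x}_{t+1})+g(\mathbf{z}_{t+1})-(f_t(\mathbf{x}^* )+g(\mathbf{z}^* ))\ge-F$ for every $t$ and every feasible $(\mathbf{x}^*,\mathbf{z}^* )$. *)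

theory Defs
  imports "HOL-Analysis.Analysis"
begin

section \<open>Extended-real-valued convex functions\<close>

text \<open>Functions into \<open>\<real> \<union> {+\<infinity>}\<close> are functions into \<^typ>\<open>ereal\<close> that never take the
  value \<open>-\<infinity>\<close>; the latter is part of \<open>proper_fun\<close>. Convexity and closedness are those of the
  epigraph, because \<^const>\<open>convex_on\<close> and \<^const>\<open>epigraph\<close> cover real-valued functions only.\<close>

definition ereal_epigraph :: "('a \<Rightarrow> ereal) \<Rightarrow> ('a \<times> real) set" where
  "ereal_epigraph g = {(z, r). g z \<le> ereal r}"

definition convex_fun :: "('a::real_vector \<Rightarrow> ereal) \<Rightarrow> bool" where
  "convex_fun g \<longleftrightarrow> convex (ereal_epigraph g)"

definition closed_fun :: "('a::topological_space \<Rightarrow> ereal) \<Rightarrow> bool" where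
  "closed_fun g \<longleftrightarrow> closed (ereal_epigraph g)"

definition proper_fun :: "('a \<Rightarrow> ereal) \<Rightarrow> bool" where
  "proper_fun g \<longleftrightarrow> (\<forall>z. g z \<noteq> -\<infinity>) \<and> (\<exists>z. g z \<noteq> \<infinity>)"

text \<open>The subdifferential is empty outside the effective domain.\<close>

definition subdifferential :: "('a::real_inner \<Rightarrow> ereal) \<Rightarrow> 'a \<Rightarrow> 'a set" where
  "subdifferential g z =
     {s. \<bar>g z\<bar> \<noteq> \<infinity> \<and> (\<forall>z'. g z' \<ge> g z + ereal (s \<bullet> (z' - z)))}"

definition strongly_convex_fun :: "real \<Rightarrow> ('a::real_inner \<Rightarrow> ereal) \<Rightarrow> bool" where
  "strongly_convex_fun \<beta> g \<longleftrightarrow>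
     (\<forall>z z'. \<forall>s\<in>subdifferential g z.
        g z' \<ge> g z + ereal (s \<bullet> (z' - z) + \<beta> / 2 * (norm (z' - z))\<^sup>2))"


section \<open>Bregman divergences\<close>

definition bregman_generator :: "('a::real_inner \<Rightarrow> real) \<Rightarrow> ('a \<Rightarrow> 'a) \<Rightarrow> bool" where
  "bregman_generator \<phi> grad \<longleftrightarrow>
     (\<forall>v. GDERIV \<phi> v :> grad v) \<and> continuous_on UNIV grad \<and>
     (\<forall>u v s. u \<noteq> v \<longrightarrow> 0 < s \<longrightarrow> s < 1 \<longrightarrow>
        \<phi> ((1 - s) *\<^sub>R u + s *\<^sub>R v) < (1 - s) * \<phi> u + s * \<phi> v)"

definition bregman :: "('a::real_inner \<Rightarrow> real) \<Rightarrow> ('a \<Rightarrow> 'a) \<Rightarrow> 'a \<Rightarrow> 'a \<Rightarrow> real" where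
  "bregman \<phi> grad u v = \<phi> u - \<phi> v - grad v \<bullet> (u - v)"


section \<open>Eigenvalues of real square matrices\<close>

definition eigenvalues :: "real^'n^'n \<Rightarrow> real set" where
  "eigenvalues M = {l. \<exists>v. v \<noteq> 0 \<and> M *v v = l *\<^sub>R v}"

definition is_smallest_eigenvalue :: "real^'n^'n \<Rightarrow> real \<Rightarrow> bool" where
  "is_smallest_eigenvalue M l \<longleftrightarrow> l \<in> eigenvalues M \<and> (\<forall>k\<in>eigenvalues M. l \<le> k)"

definition is_largest_eigenvalue :: "real^'n^'n \<Rightarrow> real \<Rightarrow> bool" where
  "is_largest_eigenvalue M l \<longleftrightarrow> l \<in> eigenvalues M \<and> (\<forall>k\<in>eigenvalues M. k \<le> l)"


section \<open>Online ADM without Bregman term and with time-varying penalty\<close>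

definition residual ::
    "real^'n^'m \<Rightarrow> real^'k^'m \<Rightarrow> real^'m \<Rightarrow> real^'n \<Rightarrow> real^'k \<Rightarrow> real^'m" where
  "residual A B c x z = A *v x + B *v z - c"

definition feasible ::
    "real^'n^'m \<Rightarrow> real^'k^'m \<Rightarrow> real^'m \<Rightarrow> (real^'k) set \<Rightarrow> ((real^'n) \<times> (real^'k)) set" where
  "feasible A B c Z = {(x, z). z \<in> Z \<and> A *v x + B *v z = c}"

text \<open>Rounds are numbered from 1; the values at index 0 of all sequences are irrelevant.\<close>

definition oadm ::
    "real^'n^'m \<Rightarrow> real^'k^'m \<Rightarrow> real^'m \<Rightarrow> (real^'k) set \<Rightarrow>
     (nat \<Rightarrow> real^'n \<Rightarrow> real) \<Rightarrow> (real^'k \<Rightarrow> ereal) \<Rightarrow> (nat \<Rightarrow> real) \<Rightarrow>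
     (nat \<Rightarrow> real^'n) \<Rightarrow> (nat \<Rightarrow> real^'k) \<Rightarrow> (nat \<Rightarrow> real^'m) \<Rightarrow> bool" where
  "oadm A B c Z f g \<rho> x z y \<longleftrightarrow>
     (\<forall>t\<ge>1.
        is_arg_min
          (\<lambda>u. f t u + y t \<bullet> residual A B c u (z t)
               + \<rho> (t + 1) / 2 * (norm (residual A B c u (z t)))\<^sup>2)
          (\<lambda>u. True) (x (t + 1)) \<and>
        is_arg_min
          (\<lambda>w. g w + ereal (y t \<bullet> residual A B c (x (t + 1)) w
               + \<rho> (t + 1) / 2 * (norm (residual A B c (x (t + 1)) w))\<^sup>2))
          (\<lambda>w. w \<in> Z) (z (t + 1)) \<and>
        y (t + 1) = y t + \<rho> (t + 1) *\<^sub>R residual A B c (x (t + 1)) (z (t + 1)))"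

text \<open>The best fixed cost in hindsight is an infimum, which is the minimum whenever that is attained.\<close>

definition regret2 ::
    "real^'n^'m \<Rightarrow> real^'k^'m \<Rightarrow> real^'m \<Rightarrow> (real^'k) set \<Rightarrow>
     (nat \<Rightarrow> real^'n \<Rightarrow> real) \<Rightarrow> (real^'k \<Rightarrow> ereal) \<Rightarrow>
     (nat \<Rightarrow> real^'n) \<Rightarrow> (nat \<Rightarrow> real^'k) \<Rightarrow> nat \<Rightarrow> ereal" where
  "regret2 A B c Z f g xhat z T =
     (\<Sum>t=1..T. ereal (f t (xhat t)) + g (z t))
     - (INF (u, w)\<in>feasible A B c Z. \<Sum>t=1..T. ereal (f t u) + g w)"

definition constraint_regret ::
    "real^'n^'m \<Rightarrow> real^'k^'m \<Rightarrow> real^'m \<Rightarrow>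
     (nat \<Rightarrow> real^'n) \<Rightarrow> (nat \<Rightarrow> real^'k) \<Rightarrow> nat \<Rightarrow> real" where
  "constraint_regret A B c x z T =
     (\<Sum>t=1..T. (norm (A *v x (t + 1) + B *v z (t + 1) - c))\<^sup>2
              + (norm (B *v z (t + 1) - B *v z t))\<^sup>2)"

end

(*
  Optimality of the x- and z-updates (with strong convexity of g) gives a per-round inequality in which
  the multiplier terms |y_t|^2 - |y_{t+1}|^2 carry the decreasing weights 1/(2 rho_{t+1}) and so sum to
  at most 0, while the terms |B(z_t - z)|^2 - |B(z_{t+1} - z)|^2 carry weights rho_{t+1}/2 that grow by
  beta_2/(2 lambda_max) per round; strong convexity pays exactly for this growth.
  For R_2, moving from x_{t+1} to xhat_t costs G_f |x_{t+1} - xhat_t|, which the negative term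
  -rho/2 |A x_{t+1} + B z_t - c|^2 absorbs up to G_f^2 / (2 lambda_min rho). For R^c, monotonicity of the
  subdifferential of g makes the residual and B z_{t+1} - B z_t form an obtuse angle, which splits that
  negative term; in the first round this uses that z_1 minimizes g and y_1 = 0.
  Strong convexity is assumed at subgradients only. Since g is closed and nonnegative, it passes to
  segments by approximating a point by its proximal points, where subgradients exist.
*)
theory Submission
  imports Defs
begin

text \<open>Dividing by \<open>s\<close> and letting \<open>s\<close> decrease to 0 removes the
  quadratic term. The eigenvector equation of a Rayleigh minimizer and the first-order conditions of
  the updates both come from this limit.\<close>

lemma nonneg_of_quadratic_perturbation:
  fixes a k :: real
  assumes "\<And>s. 0 < s \<Longrightarrow> s < 1 \<Longrightarrow> 0 \<le> s * a + s\<^sup>2 * k"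
  shows "0 \<le> a"
proof -
  have "\<forall>\<^sub>F s in at_right (0::real). 0 \<le> a + s * k"
  proof -
    have "\<forall>\<^sub>F s in at_right (0::real). s \<in> {0<..<1}"
      by (rule eventually_at_right_real) simp
    then show ?thesis
    proof eventually_elim
      case (elim s)
      then have "0 \<le> s * (a + s * k)"
        using assms[of s] by (simp add: algebra_simps power2_eq_square)
      with elim show ?case by (simp add: zero_le_mult_iff)
    qed
  qed
  moreover have "((\<lambda>s. a + s * k) \<longlongrightarrow> a + 0 * k) (at_right 0)"
    by (intro tendsto_intros)
  ultimately have "0 \<le> a + 0 * k"
    by (intro tendsto_lowerbound) auto
  then show ?thesis by simp
qed

section \<open>Extreme eigenvalues and norm bounds for matrices\<close>

lemma symmetric_matrix_least_eigenvalue: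
  fixes S :: "real^'n^'n"
  assumes "transpose S = S"
  obtains l where "l \<in> eigenvalues S" "\<And>v. l * (norm v)\<^sup>2 \<le> v \<bullet> (S *v v)"
proof -
  have sym: "u \<bullet> (S *v v) = v \<bullet> (S *v u)" for u v
    using assms by (metis dot_lmul_matrix inner_commute transpose_matrix_vector)
  \<comment> \<open>The quadratic form attains its minimum on the compact unit sphere; the minimum
    is the eigenvalue sought and the minimizer its eigenvector.\<close>
  have "\<exists>v\<in>sphere 0 1. \<forall>w\<in>sphere 0 1. v \<bullet> (S *v v) \<le> w \<bullet> (S *v w)"
    by (rule continuous_attains_inf) (auto intro!: continuous_intros matrix_vector_mult_linear_continuous_on)
  then obtain v where v: "norm v = 1" and least: "\<And>w. norm w = 1 \<Longrightarrow> v \<bullet> (S *v v) \<le> w \<bullet> (S *v w)"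
    by auto
  define l where "l = v \<bullet> (S *v v)"
  have bound: "l * (norm w)\<^sup>2 \<le> w \<bullet> (S *v w)" for w
  proof (cases "w = 0")
    case False
    define u where "u = w /\<^sub>R norm w"
    have w: "w = norm w *\<^sub>R u" and "norm u = 1"
      using False by (auto simp: u_def)
    then have "l \<le> u \<bullet> (S *v u)"
      using least l_def by simp
    moreover have "w \<bullet> (S *v w) = (norm w)\<^sup>2 * (u \<bullet> (S *v u))"
      by (subst (1 2) w) (simp add: matrix_vector_mult_scaleR power2_eq_square)
    ultimately show ?thesis
      by (simp add: mult.commute[of _ "(norm w)\<^sup>2"] mult_left_mono)
  qed auto
  \<comment> \<open>By \<open>bound\<close> the form of \<open>S\<close> minus \<open>l\<close>
    times the identity is nonnegative, and it vanishes at \<open>v\<close>. So its first variation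
    at \<open>v\<close> is nonnegative in every direction \<open>w\<close>; the direction opposite
    to \<open>S *v v - l *\<^sub>R v\<close> then forces that vector to be 0.\<close>
  have "0 \<le> w \<bullet> (S *v v - l *\<^sub>R v)" for w
  proof -
    have "0 \<le> 2 * (w \<bullet> (S *v v - l *\<^sub>R v))"
    proof (rule nonneg_of_quadratic_perturbation)
      fix s :: real
      have "l * (norm (v + s *\<^sub>R w))\<^sup>2 \<le> (v + s *\<^sub>R w) \<bullet> (S *v (v + s *\<^sub>R w))"
        by (rule bound)
      moreover have "(v + s *\<^sub>R w) \<bullet> (S *v (v + s *\<^sub>R w)) = l + 2 * s * (w \<bullet> (S *v v)) + s\<^sup>2 * (w \<bullet> (S *v w))"
        by (simp add: l_def algebra_simps matrix_vector_mult_scaleR inner_simps power2_eq_square sym[of v w])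
      moreover have "(norm (v + s *\<^sub>R w))\<^sup>2 = 1 + 2 * s * (w \<bullet> v) + s\<^sup>2 * (w \<bullet> w)"
        using v unfolding power2_norm_eq_inner
        by (simp add: inner_simps inner_commute power2_eq_square norm_eq_1)
      ultimately show "0 \<le> s * (2 * (w \<bullet> (S *v v - l *\<^sub>R v))) + s\<^sup>2 * (w \<bullet> (S *v w) - l * (w \<bullet> w))"
        by (simp add: inner_simps algebra_simps)
    qed
    then show ?thesis by simp
  qed
  from this[of "- (S *v v - l *\<^sub>R v)"] have "(S *v v - l *\<^sub>R v) \<bullet> (S *v v - l *\<^sub>R v) \<le> 0"
    unfolding inner_minus_left by linarith
  then have "S *v v = l *\<^sub>R v"
    by (metis eq_iff_diff_eq_0 inner_eq_zero_iff inner_ge_zero order_antisym)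
  moreover have "v \<noteq> 0" using v by auto
  ultimately have "l \<in> eigenvalues S"
    by (auto simp: eigenvalues_def)
  then show thesis using bound that by blast
qed

text \<open>Negating the Gram matrix turns the lower bound by a least eigenvalue \<open>k\<close>
  into an upper bound by \<open>- k\<close>, which is an eigenvalue of
  \<open>transpose B ** B\<close> and so at most \<open>l\<close>.\<close>

lemma norm_matrix_vector_mult_le:
  fixes B :: "real^'k^'m"
  assumes "is_largest_eigenvalue (transpose B ** B) l"
  shows "(norm (B *v v))\<^sup>2 \<le> l * (norm v)\<^sup>2"
proof -
  have "transpose (- (transpose B ** B)) = - (transpose B ** B)"
    by (simp add: vec_eq_iff transpose_def matrix_matrix_mult_def mult.commute)
  then obtain k where k: "k \<in> eigenvalues (- (transpose B ** B))"
    "\<And>v. k * (norm v)\<^sup>2 \<le> v \<bullet> (- (transpose B ** B) *v v)"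
    using symmetric_matrix_least_eigenvalue by blast
  have neg: "- (transpose B ** B) *v v = - (transpose B *v (B *v v))" for v
    using matrix_vector_mult_diff_rdistrib[of 0 "transpose B ** B" v] by (simp add: matrix_vector_mul_assoc)
  have "- k \<in> eigenvalues (transpose B ** B)"
    using k(1) by (auto simp: eigenvalues_def neg matrix_vector_mul_assoc[symmetric] minus_equation_iff)
  then have "- k \<le> l"
    using assms by (simp add: is_largest_eigenvalue_def)
  moreover have "(norm (B *v v))\<^sup>2 \<le> - k * (norm v)\<^sup>2"
    using k(2)[of v] by (simp add: neg power2_norm_eq_inner dot_lmul_matrix[symmetric] flip: transpose_matrix_vector)
  ultimately show ?thesis
    by (meson mult_right_mono order_trans zero_le_power2)
qed

text \<open>The norm of \<open>A *v v\<close> is governed by \<open>transpose A ** A\<close>, the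
  hypothesis by \<open>A ** transpose A\<close>. Multiplication by \<open>A\<close> carries
  eigenvectors of the former to eigenvectors of the latter with the same eigenvalue; invertibility
  keeps them nonzero.\<close>

lemma norm_matrix_vector_mult_ge:
  fixes A :: "real^'n^'n"
  assumes "invertible A" and "is_smallest_eigenvalue (A ** transpose A) l"
  shows "l * (norm v)\<^sup>2 \<le> (norm (A *v v))\<^sup>2"
proof -
  have "transpose (transpose A ** A) = transpose A ** A"
    by (simp add: matrix_transpose_mul)
  then obtain k where k: "k \<in> eigenvalues (transpose A ** A)"
    "\<And>v. k * (norm v)\<^sup>2 \<le> v \<bullet> ((transpose A ** A) *v v)"
    using symmetric_matrix_least_eigenvalue by blast
  obtain w where w: "w \<noteq> 0" "(transpose A ** A) *v w = k *\<^sub>R w"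
    using k(1) by (auto simp: eigenvalues_def)
  have "A *v w \<noteq> 0"
    using \<open>invertible A\<close> w(1) by (metis invertible_def matrix_left_invertible_ker)
  moreover have "(A ** transpose A) *v (A *v w) = k *\<^sub>R (A *v w)"
    using w(2) by (metis matrix_vector_mul_assoc matrix_vector_mult_scaleR)
  ultimately have "k \<in> eigenvalues (A ** transpose A)"
    by (auto simp: eigenvalues_def)
  then have "l \<le> k"
    using assms by (simp add: is_smallest_eigenvalue_def)
  moreover have "k * (norm v)\<^sup>2 \<le> (norm (A *v v))\<^sup>2"
    using k(2)[of v] by (simp add: power2_norm_eq_inner dot_lmul_matrix[symmetric] matrix_vector_mul_assoc[symmetric] flip: transpose_matrix_vector)
  ultimately show ?thesis
    by (meson mult_right_mono order_trans zero_le_power2)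
qed

section \<open>Subgradients and first-order conditions\<close>

lemma convex_on_subdifferential_nonempty:
  fixes f :: "'a::euclidean_space \<Rightarrow> real"
  assumes "convex_on UNIV f"
  obtains s where "s \<in> subdifferential (\<lambda>v. ereal (f v)) u"
proof -
  \<comment> \<open>A hyperplane separates the open vertical ray below the graph point over
    \<open>u\<close> from the epigraph; its normal, rescaled by the vertical component
    \<open>q\<close>, yields the subgradient.\<close>
  let ?S = "{u} \<times> {..<f u}"
  have "convex ?S" "?S \<noteq> {}" "epigraph UNIV f \<noteq> {}" "?S \<inter> epigraph UNIV f = {}"
    by (auto simp: convex_Times epigraph_def intro: lt_ex)
  moreover have "convex (epigraph UNIV f)"
    using assms by (simp add: convex_epigraph)
  ultimately obtain a b where a: "a \<noteq> 0" and "\<forall>x\<in>?S. a \<bullet> x \<le> b" and above: "\<forall>x\<in>epigraph UNIV f. b \<le> a \<bullet> x"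
    using separating_hyperplane_sets by metis
  obtain p q where pq: "a = (p, q)" by fastforce
  have below: "p \<bullet> u + q * r \<le> b" if "r < f u" for r
    using \<open>\<forall>x\<in>?S. a \<bullet> x \<le> b\<close> that by (auto simp: pq)
  have above: "b \<le> p \<bullet> v + q * r" if "f v \<le> r" for v r
    using above that by (auto simp: pq epigraph_def)
  have "p \<bullet> u + q * (f u - 1) \<le> p \<bullet> u + q * f u"
    using below[of "f u - 1"] above[of u "f u"] by simp
  then have "0 \<le> q" by (simp add: algebra_simps)
  have limit: "p \<bullet> u + q * f u \<le> b"
  proof (rule tendsto_upperbound)
    show "((\<lambda>r. p \<bullet> u + q * r) \<longlongrightarrow> p \<bullet> u + q * f u) (at_left (f u))"
      by (intro tendsto_intros)
    show "\<forall>\<^sub>F r in at_left (f u). p \<bullet> u + q * r \<le> b"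
      using below by (intro eventually_at_leftI[of "f u - 1"]) auto
  qed auto
  \<comment> \<open>The hyperplane cannot be vertical, because the epigraph lies over every point:
    testing at \<open>u - p\<close> would give \<open>p = 0\<close>.\<close>
  have "q \<noteq> 0"
  proof
    assume "q = 0"
    then have "p \<bullet> u \<le> p \<bullet> (u - p)"
      using limit above[of "u - p" "f (u - p)"] by simp
    then have "p \<bullet> p \<le> 0"
      by (simp add: inner_simps)
    then have "p = 0" 
      by (metis inner_eq_zero_iff inner_ge_zero order_antisym)
    then show False using a pq \<open>q = 0\<close> by (simp add: zero_prod_def)
  qed
  have "f u + (- (1 / q) *\<^sub>R p) \<bullet> (v - u) \<le> f v" for v
  proof -
    have "p \<bullet> u + q * f u \<le> p \<bullet> v + q * f v"
      using limit above[of v "f v"] by simp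
    then show ?thesis
      using \<open>0 \<le> q\<close> \<open>q \<noteq> 0\<close> by (simp add: field_simps inner_simps)
  qed
  then have "- (1 / q) *\<^sub>R p \<in> subdifferential (\<lambda>v. ereal (f v)) u"
    by (simp add: subdifferential_def)
  then show thesis by (rule that)
qed

text \<open>Compare \<open>p\<close> with a point of the segment to \<open>z\<close> and let
  \<open>s\<close> tend to 0. Here \<open>b\<close> stands for the value at \<open>z\<close> and
  \<open>l\<close> for the slope of \<open>q\<close>. The modulus \<open>\<mu>\<close> is 0 for
  plain convexity and half the modulus times the squared distance for strong convexity.\<close>

lemma arg_min_first_order:
  fixes g :: "'a::real_vector \<Rightarrow> ereal" and q :: "'a \<Rightarrow> real"
  assumes min: "is_arg_min (\<lambda>w. g w + ereal (q w)) (\<lambda>w. w \<in> Z) p"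
    and "convex Z" and "z \<in> Z" and gp: "g p = ereal a"
    and seg: "\<And>s. 0 < s \<Longrightarrow> s < 1 \<Longrightarrow>
      g ((1 - s) *\<^sub>R p + s *\<^sub>R z) \<le> ereal ((1 - s) * a + s * b - s * (1 - s) * \<mu>)"
    and quad: "\<And>s. q ((1 - s) *\<^sub>R p + s *\<^sub>R z) = q p + s * l + s\<^sup>2 * k"
  shows "a - l + \<mu> \<le> b"
proof -
  have "0 \<le> b - a + l - \<mu>"
  proof (rule nonneg_of_quadratic_perturbation)
    fix s :: real
    assume s: "0 < s" "s < 1"
    let ?w = "(1 - s) *\<^sub>R p + s *\<^sub>R z"
    have "p \<in> Z" using min by (simp add: is_arg_min_def)
    then have "?w \<in> Z"
      using s \<open>convex Z\<close> \<open>z \<in> Z\<close> by (intro convexD) auto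
    then have "g p + ereal (q p) \<le> g ?w + ereal (q ?w)"
      using min by (simp add: is_arg_min_def linorder_not_less)
    also have "\<dots> \<le> ereal ((1 - s) * a + s * b - s * (1 - s) * \<mu>) + ereal (q ?w)"
      using seg[OF s] by (intro add_right_mono)
    finally have "a + q p \<le> (1 - s) * a + s * b - s * (1 - s) * \<mu> + q ?w"
      by (simp add: gp)
    then show "0 \<le> s * (b - a + l - \<mu>) + s\<^sup>2 * (\<mu> + k)"
      unfolding quad by (simp add: algebra_simps power2_eq_square)
  qed
  then show ?thesis by simp
qed

section \<open>Proximal points and strong convexity on segments\<close>

lemma convex_fun_segment:
  assumes "convex_fun g" "g u \<le> ereal a" "g v \<le> ereal b" "0 < s" "s < 1"
  shows "g ((1 - s) *\<^sub>R u + s *\<^sub>R v) \<le> ereal ((1 - s) * a + s * b)"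
proof -
  have "(1 - s) *\<^sub>R (u, a) + s *\<^sub>R (v, b) \<in> ereal_epigraph g"
    using assms by (intro convexD) (auto simp: convex_fun_def ereal_epigraph_def)
  then show ?thesis by (simp add: ereal_epigraph_def)
qed

text \<open>Take for \<open>p\<close> a minimizer of \<open>g\<close> plus \<open>l / 2\<close>
  times the squared distance to \<open>w\<close>. The first-order condition at \<open>p\<close> is
  the subgradient claim, and comparison with \<open>w\<close> itself is the distance bound.\<close>

lemma proximal_point:
  fixes g :: "'a::euclidean_space \<Rightarrow> ereal"
  assumes "convex_fun g" "closed_fun g" and nonneg: "\<And>w. 0 \<le> g w"
    and gw: "g w \<le> ereal m" and "0 < l"
  obtains p where "l *\<^sub>R (w - p) \<in> subdifferential g p" "l * (norm (p - w))\<^sup>2 \<le> 2 * m"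
proof -
  define h where "h = (\<lambda>(v, r). r + l / 2 * (norm (v - w))\<^sup>2)"
  \<comment> \<open>Closedness makes \<open>g\<close> only lower semicontinuous, so the minimization
    runs over the epigraph, where \<open>h\<close> is continuous. A point of the graph of
    \<open>g\<close> outside the compact \<open>K\<close> is higher than \<open>m\<close> or farther
    from \<open>w\<close> than the radius; either way \<open>h\<close> is at least \<open>m\<close>
    there, which is the value at \<open>(w, m)\<close>.\<close>
  define K where "K = ereal_epigraph g \<inter> (cball w (sqrt (2 * m / l)) \<times> {0..m})"
  have "ereal 0 \<le> ereal m"
    using nonneg[of w] gw unfolding zero_ereal_def by (rule order_trans)
  then have "0 \<le> m" by simp
  have "compact K"
    using \<open>closed_fun g\<close> unfolding K_def closed_fun_def
    by (intro closed_Int_compact compact_Times compact_cball compact_Icc)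
  moreover have wK: "(w, m) \<in> K"
    using gw \<open>0 \<le> m\<close> \<open>0 < l\<close> by (simp add: K_def ereal_epigraph_def)
  moreover have "continuous_on K h"
    unfolding h_def case_prod_unfold by (intro continuous_intros)
  ultimately obtain p r where pr: "(p, r) \<in> K" and least: "\<And>v r'. (v, r') \<in> K \<Longrightarrow> h (p, r) \<le> h (v, r')"
    using continuous_attains_inf[of K h] by fastforce
  have "h (p, r) \<le> m"
    using least[OF wK] by (simp add: h_def)
  have "g p \<le> ereal r" "0 \<le> r" "r \<le> m"
    using pr by (auto simp: K_def ereal_epigraph_def)
  then obtain a where a: "g p = ereal a" "0 \<le> a" "a \<le> r"
    using nonneg[of p] by (cases "g p") auto
  have min: "is_arg_min (\<lambda>v. g v + ereal (l / 2 * (norm (v - w))\<^sup>2)) (\<lambda>v. v \<in> UNIV) p"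
    unfolding is_arg_min_linorder
  proof safe
    fix v
    have ph: "g p + ereal (l / 2 * (norm (p - w))\<^sup>2) \<le> ereal (h (p, r))"
      using a by (simp add: h_def)
    show "g p + ereal (l / 2 * (norm (p - w))\<^sup>2) \<le> g v + ereal (l / 2 * (norm (v - w))\<^sup>2)"
    proof (cases "g v")
      case (real b)
      then have "0 \<le> b" using nonneg[of v] by simp
      have "h (p, r) \<le> h (v, b)"
      proof (cases "(v, b) \<in> K")
        case False
        then consider "m < b" | "sqrt (2 * m / l) < norm (v - w)"
          using real \<open>0 \<le> b\<close> by (force simp: K_def ereal_epigraph_def dist_norm norm_minus_commute)
        then have "m \<le> h (v, b)"
        proof cases
          case 1
          then show ?thesis using \<open>0 < l\<close> by (simp add: h_def add_increasing2)
        next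
          case 2
          then have "2 * m / l \<le> (norm (v - w))\<^sup>2"
            using \<open>0 \<le> m\<close> \<open>0 < l\<close> by (metis less_eq_real_def norm_ge_zero real_sqrt_le_iff real_sqrt_abs abs_of_nonneg)
          then show ?thesis using \<open>0 < l\<close> \<open>0 \<le> b\<close> by (simp add: h_def field_simps)
        qed
        with \<open>h (p, r) \<le> m\<close> show ?thesis by simp
      qed (use least in auto)
      then show ?thesis
        using ph real a by (auto simp: h_def)
    qed (use nonneg[of v] in auto)
  qed simp
  have "g p + ereal ((l *\<^sub>R (w - p)) \<bullet> (v - p)) \<le> g v" for v
  proof (cases "g v")
    case (real b)
    have "a - l * ((p - w) \<bullet> (v - p)) + 0 \<le> b"
    proof (rule arg_min_first_order[OF min convex_UNIV UNIV_I a(1)])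
      show "g ((1 - s) *\<^sub>R p + s *\<^sub>R v) \<le> ereal ((1 - s) * a + s * b - s * (1 - s) * 0)"
        if "0 < s" "s < 1" for s
        using convex_fun_segment[OF \<open>convex_fun g\<close> _ _ that] a(1) real by simp
      show "l / 2 * (norm ((1 - s) *\<^sub>R p + s *\<^sub>R v - w))\<^sup>2
          = l / 2 * (norm (p - w))\<^sup>2 + s * (l * ((p - w) \<bullet> (v - p))) + s\<^sup>2 * (l / 2 * (norm (v - p))\<^sup>2)" for s
        unfolding power2_norm_eq_inner
        by (simp add: inner_simps inner_commute algebra_simps power2_eq_square)
    qed
    then show ?thesis
      using real a by (simp add: inner_simps algebra_simps)
  qed (use nonneg[of v] in auto)
  then have "l *\<^sub>R (w - p) \<in> subdifferential g p"
    using a by (simp add: subdifferential_def)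
  moreover have "l * (norm (p - w))\<^sup>2 \<le> 2 * m"
    using \<open>h (p, r) \<le> m\<close> \<open>0 \<le> r\<close> by (simp add: h_def)
  ultimately show thesis by (rule that)
qed

text \<open>At a proximal point \<open>p\<close> of the intermediate point \<open>w\<close>, the
  strong convexity inequalities towards \<open>u\<close> and \<open>v\<close> are averaged with
  weights \<open>1 - s\<close> and \<open>s\<close>. The linear term has a favourable sign, and
  closedness of the epigraph carries the resulting bound \<open>e p\<close> to the limit
  \<open>w\<close>.\<close>

lemma strongly_convex_fun_segment:
  fixes g :: "'a::euclidean_space \<Rightarrow> ereal"
  assumes "convex_fun g" "closed_fun g" and nonneg: "\<And>w. 0 \<le> g w"
    and "strongly_convex_fun \<beta> g"
    and gu: "g u \<le> ereal a" and gv: "g v \<le> ereal b" and s: "0 < s" "s < 1"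
  shows "g ((1 - s) *\<^sub>R u + s *\<^sub>R v)
    \<le> ereal ((1 - s) * a + s * b - s * (1 - s) * (\<beta> / 2 * (norm (v - u))\<^sup>2))"
proof -
  define w where "w = (1 - s) *\<^sub>R u + s *\<^sub>R v"
  define m where "m = (1 - s) * a + s * b"
  define e where "e = (\<lambda>p. m - \<beta> / 2 * ((1 - s) * (norm (u - p))\<^sup>2 + s * (norm (v - p))\<^sup>2))"
  have gw: "g w \<le> ereal m"
    unfolding w_def m_def using assms by (intro convex_fun_segment)
  have "\<exists>p. (p, e p) \<in> ereal_epigraph g \<and> real (Suc n) * (norm (p - w))\<^sup>2 \<le> 2 * m" for n
  proof -
    obtain p where p: "real (Suc n) *\<^sub>R (w - p) \<in> subdifferential g p"
      and near: "real (Suc n) * (norm (p - w))\<^sup>2 \<le> 2 * m"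
      using proximal_point[OF assms(1-3) gw, of "real (Suc n)"] by auto
    define d where "d = real (Suc n) *\<^sub>R (w - p)"
    obtain r where r: "g p = ereal r"
      using p by (cases "g p") (auto simp: subdifferential_def)
    have sub: "r + (d \<bullet> (q - p) + \<beta> / 2 * (norm (q - p))\<^sup>2) \<le> k" if "g q \<le> ereal k" for q k
    proof -
      have "ereal r + ereal (d \<bullet> (q - p) + \<beta> / 2 * (norm (q - p))\<^sup>2) \<le> g q"
        using \<open>strongly_convex_fun \<beta> g\<close> p r unfolding strongly_convex_fun_def d_def by metis
      then have "ereal r + ereal (d \<bullet> (q - p) + \<beta> / 2 * (norm (q - p))\<^sup>2) \<le> ereal k"
        using that by (rule order_trans)
      then show ?thesis by simp
    qed
    have "(1 - s) * (r + (d \<bullet> (u - p) + \<beta> / 2 * (norm (u - p))\<^sup>2))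
        + s * (r + (d \<bullet> (v - p) + \<beta> / 2 * (norm (v - p))\<^sup>2)) \<le> m"
      unfolding m_def using s sub[OF gu] sub[OF gv] by (intro add_mono mult_left_mono) auto
    moreover have "(1 - s) * (d \<bullet> (u - p)) + s * (d \<bullet> (v - p)) = d \<bullet> (w - p)"
      unfolding w_def by (simp add: inner_simps algebra_simps)
    moreover have "0 \<le> d \<bullet> (w - p)"
      by (simp add: d_def)
    ultimately have "r \<le> e p"
      unfolding e_def by (simp add: algebra_simps diff_divide_distrib)
    then show ?thesis
      using near r by (intro exI[of _ p] conjI) (simp_all add: ereal_epigraph_def)
  qed
  then obtain P where P: "\<And>n. (P n, e (P n)) \<in> ereal_epigraph g"
    and near: "\<And>n. real (Suc n) * (norm (P n - w))\<^sup>2 \<le> 2 * m"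
    by metis
  have "(\<lambda>n. (norm (P n - w))\<^sup>2) \<longlonglongrightarrow> 0"
  proof (rule tendsto_sandwich[of "\<lambda>_. 0"])
    show "\<forall>\<^sub>F n in sequentially. (norm (P n - w))\<^sup>2 \<le> 2 * m * inverse (real (Suc n))"
      using near by (intro always_eventually allI) (simp add: field_simps del: of_nat_Suc)
    show "(\<lambda>n. 2 * m * inverse (real (Suc n))) \<longlonglongrightarrow> 0"
      using tendsto_mult_left[OF LIMSEQ_inverse_real_of_nat, of "2 * m"] by simp
  qed auto
  then have "(\<lambda>n. norm (P n - w)) \<longlonglongrightarrow> 0"
    using tendsto_real_sqrt by force
  then have lim: "P \<longlonglongrightarrow> w"
    using Lim_null tendsto_norm_zero_iff by blast
  then have "(\<lambda>n. (P n, e (P n))) \<longlonglongrightarrow> (w, e w)"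
    unfolding e_def by (intro tendsto_intros)
  then have "(w, e w) \<in> ereal_epigraph g"
    using \<open>closed_fun g\<close> P closed_sequentially[of _ "\<lambda>n. (P n, e (P n))"]
    by (simp add: closed_fun_def)
  \<comment> \<open>The distances from \<open>w\<close> to the endpoints are \<open>s\<close> and
    \<open>1 - s\<close> times the length of the segment; this turns \<open>e w\<close> into the
    claimed bound.\<close>
  moreover have "(1 - s) * (norm (u - w))\<^sup>2 + s * (norm (v - w))\<^sup>2 = s * (1 - s) * (norm (v - u))\<^sup>2"
  proof -
    have "u - w = s *\<^sub>R (u - v)" "v - w = (1 - s) *\<^sub>R (v - u)"
      by (simp_all add: w_def algebra_simps)
    then show ?thesis
      by (simp add: power_mult_distrib norm_minus_commute) (simp add: power2_eq_square algebra_simps)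
  qed
  ultimately show ?thesis
    by (simp add: ereal_epigraph_def e_def flip: w_def m_def) (simp add: algebra_simps)
qed

section \<open>First-order conditions of the two updates\<close>

lemma residual_diff: "residual A B c u z = residual A B c u' z + A *v (u - u')"
  "residual A B c u z = residual A B c u z' + B *v (z - z')"
  by (simp_all add: residual_def algebra_simps)

lemma augmented_quadratic_expansion:
  fixes y r d :: "'a::real_inner"
  shows "y \<bullet> (r + s *\<^sub>R d) + \<rho> / 2 * (norm (r + s *\<^sub>R d))\<^sup>2
    = (y \<bullet> r + \<rho> / 2 * (norm r)\<^sup>2) + s * ((y + \<rho> *\<^sub>R r) \<bullet> d) + s\<^sup>2 * (\<rho> / 2 * (norm d)\<^sup>2)"
  unfolding power2_norm_eq_inner
  by (simp add: inner_simps inner_commute algebra_simps power2_eq_square)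

lemma x_update_first_order:
  fixes A :: "real^'n^'m" and B :: "real^'k^'m"
  assumes "convex_on UNIV f"
    and min: "is_arg_min (\<lambda>u. f u + y \<bullet> residual A B c u z + \<rho> / 2 * (norm (residual A B c u z))\<^sup>2)
      (\<lambda>u. True) p"
  shows "f p - (y + \<rho> *\<^sub>R residual A B c p z) \<bullet> (A *v (u - p)) \<le> f u"
proof -
  define q where "q = (\<lambda>u. y \<bullet> residual A B c u z + \<rho> / 2 * (norm (residual A B c u z))\<^sup>2)"
  have "f p - (y + \<rho> *\<^sub>R residual A B c p z) \<bullet> (A *v (u - p)) + 0 \<le> f u"
  proof (rule arg_min_first_order[of "\<lambda>u. ereal (f u)" q UNIV])
    show "is_arg_min (\<lambda>w. ereal (f w) + ereal (q w)) (\<lambda>w. w \<in> UNIV) p"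
      using min by (simp add: q_def is_arg_min_def add.assoc)
    show "ereal (f ((1 - s) *\<^sub>R p + s *\<^sub>R u)) \<le> ereal ((1 - s) * f p + s * f u - s * (1 - s) * 0)"
      if "0 < s" "s < 1" for s
      using convex_onD[OF assms(1), of s p u] that by simp
    show "q ((1 - s) *\<^sub>R p + s *\<^sub>R u)
        = q p + s * ((y + \<rho> *\<^sub>R residual A B c p z) \<bullet> (A *v (u - p)))
          + s\<^sup>2 * (\<rho> / 2 * (norm (A *v (u - p)))\<^sup>2)" for s
    proof -
      have "residual A B c ((1 - s) *\<^sub>R p + s *\<^sub>R u) z = residual A B c p z + s *\<^sub>R (A *v (u - p))"
        by (subst residual_diff(1)[of A B c _ z p]) (simp add: algebra_simps)
      then show ?thesis
        unfolding q_def by (simp only: augmented_quadratic_expansion)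
    qed
  qed auto
  then show ?thesis by simp
qed

text \<open>The dual vector \<open>y + \<rho> *\<^sub>R residual A B c u p\<close> is the multiplier
  after the round. The squared distance comes from \<open>strongly_convex_fun_segment\<close>, which
  supplies the modulus \<open>\<mu>\<close> of \<open>arg_min_first_order\<close>.\<close>

lemma z_update_first_order:
  fixes A :: "real^'n^'m" and B :: "real^'k^'m"
  assumes g: "convex_fun g" "closed_fun g" "\<And>w. 0 \<le> g w" "strongly_convex_fun \<beta> g"
    and "convex Z"
    and min: "is_arg_min (\<lambda>w. g w + ereal (y \<bullet> residual A B c u w + \<rho> / 2 * (norm (residual A B c u w))\<^sup>2))
      (\<lambda>w. w \<in> Z) p"
    and "g p = ereal a" "w \<in> Z" "g w = ereal b"
  shows "a - (y + \<rho> *\<^sub>R residual A B c u p) \<bullet> (B *v (w - p)) + \<beta> / 2 * (norm (w - p))\<^sup>2 \<le> b"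
proof (rule arg_min_first_order[OF min \<open>convex Z\<close> \<open>w \<in> Z\<close> \<open>g p = ereal a\<close>])
  show "g ((1 - s) *\<^sub>R p + s *\<^sub>R w) \<le> ereal ((1 - s) * a + s * b - s * (1 - s) * (\<beta> / 2 * (norm (w - p))\<^sup>2))"
    if "0 < s" "s < 1" for s
    using strongly_convex_fun_segment[OF g _ _ that] assms(7,9) by simp
  show "y \<bullet> residual A B c u ((1 - s) *\<^sub>R p + s *\<^sub>R w)
        + \<rho> / 2 * (norm (residual A B c u ((1 - s) *\<^sub>R p + s *\<^sub>R w)))\<^sup>2
      = y \<bullet> residual A B c u p + \<rho> / 2 * (norm (residual A B c u p))\<^sup>2
        + s * ((y + \<rho> *\<^sub>R residual A B c u p) \<bullet> (B *v (w - p)))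
        + s\<^sup>2 * (\<rho> / 2 * (norm (B *v (w - p)))\<^sup>2)" for s
  proof -
    have "residual A B c u ((1 - s) *\<^sub>R p + s *\<^sub>R w) = residual A B c u p + s *\<^sub>R (B *v (w - p))"
      by (subst residual_diff(2)[of A B c u _ p]) (simp add: algebra_simps)
    then show ?thesis
      by (simp only: augmented_quadratic_expansion)
  qed
qed

text \<open>Read \<open>r\<close> as the residual after the round, \<open>d\<close> as the change of
  \<open>B *v z\<close>, and \<open>e\<close> as the image under \<open>B\<close> of the old error.
  The left side is what the two first-order conditions leave; completing squares gives two
  telescoping differences and one negative square.\<close>

lemma oadm_step_identity:
  fixes y r d e :: "'a::real_inner"
  assumes "\<rho> > 0"
  shows "- ((y + \<rho> *\<^sub>R r) \<bullet> r) + \<rho> * (d \<bullet> (r - (e + d)))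
    = ((norm y)\<^sup>2 - (norm (y + \<rho> *\<^sub>R r))\<^sup>2) / (2 * \<rho>) - \<rho> / 2 * (norm (r - d))\<^sup>2
      + \<rho> / 2 * ((norm e)\<^sup>2 - (norm (e + d))\<^sup>2)"
  using assms unfolding power2_norm_eq_inner
  by (simp add: inner_simps inner_commute power2_eq_square field_simps)

text \<open>Summation by parts: \<open>N t\<close> pays for the change of weight at
  \<open>E (t + 1)\<close>. It serves growing weights with a positive \<open>N\<close>, and
  nonincreasing or constant weights with \<open>N\<close> equal to 0.\<close>

lemma sum_weighted_telescope_le:
  fixes a E N :: "nat \<Rightarrow> real"
  assumes "\<And>t. t \<ge> 1 \<Longrightarrow> a (t + 1) * E (t + 1) \<le> a t * E (t + 1) + N t"
  shows "(\<Sum>t=1..n. a t * (E t - E (t + 1)) - N t) \<le> a 1 * E 1 - a (n + 1) * E (n + 1)"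
proof (induction n)
  case (Suc n)
  then show ?case
    using assms[of "Suc n"] by (simp add: algebra_simps)
qed simp

text \<open>Induction, with \<open>ln q \<le> q - 1\<close> at \<open>q = (n + 1) / (n + 2)\<close>.
  The sum starts at 1/2, because round \<open>t\<close> uses \<open>\<rho> (t + 1)\<close>; hence no
  additive constant appears.\<close>

lemma sum_inverse_Suc_le_ln: "(\<Sum>t=1..n. 1 / (real t + 1)) \<le> ln (real n + 1)"
proof (induction n)
  case (Suc n)
  have "ln ((real n + 1) / (real n + 2)) \<le> (real n + 1) / (real n + 2) - 1"
    by (intro ln_le_minus_one) simp
  also have "\<dots> = - (1 / (real n + 2))"
    by (simp add: field_simps)
  finally have "1 / (real n + 2) \<le> ln (real n + 2) - ln (real n + 1)"
    by (simp add: ln_div)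
  then show ?case
    using Suc by (simp add: add.commute)
qed simp

theorem theorem10:
  fixes A :: "real^'m^'m" and B :: "real^'k^'m" and c :: "real^'m"
    and Z :: "(real^'k) set"
    and f :: "nat \<Rightarrow> real^'m \<Rightarrow> real" and g :: "real^'k \<Rightarrow> ereal"
    and \<phi> :: "real^'m \<Rightarrow> real" and grad_\<phi> :: "real^'m \<Rightarrow> real^'m"
    and x xhat :: "nat \<Rightarrow> real^'m" and z :: "nat \<Rightarrow> real^'k" and y :: "nat \<Rightarrow> real^'m"
    and \<rho> :: "nat \<Rightarrow> real"
    and G\<^sub>f \<alpha> D\<^sub>x D\<^sub>z F \<beta>\<^sub>2 lam_min_A lam_max_B :: real
    and T :: nat
  assumes "convex Z"
    and "\<And>t. t \<ge> 1 \<Longrightarrow> convex_on UNIV (f t)"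
    and "closed_fun g" and "proper_fun g" and "convex_fun g"
    and "feasible A B c Z \<noteq> {}"
    and run: "oadm A B c Z f g \<rho> x z y"
    and a: "\<And>t u s. t \<ge> 1 \<Longrightarrow> s \<in> subdifferential (\<lambda>v. ereal (f t v)) u \<Longrightarrow> norm s \<le> G\<^sub>f"
    and b: "bregman_generator \<phi> grad_\<phi>" "\<alpha> > 0"
      "\<And>u v. bregman \<phi> grad_\<phi> u v \<ge> \<alpha> / 2 * (norm (u - v))\<^sup>2"
    and c: "x 1 = 0" "y 1 = 0" "z 1 = 0" "0 \<in> Z"
      "\<And>u w. (u, w) \<in> feasible A B c Z \<Longrightarrow> bregman \<phi> grad_\<phi> u (x 1) \<le> D\<^sub>x\<^sup>2"
      "\<And>u w. (u, w) \<in> feasible A B c Z \<Longrightarrow> norm (w - z 1) \<le> D\<^sub>z"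
    and d: "g (z 1) = 0" "\<And>w. g w \<ge> 0"
    and e: "F > 0"
      "\<And>t u w. t \<ge> 1 \<Longrightarrow> (u, w) \<in> feasible A B c Z \<Longrightarrow>
         (ereal (f t (x (t + 1))) + g (z (t + 1))) - (ereal (f t u) + g w) \<ge> ereal (- F)"
    and "invertible A"
    and "is_smallest_eigenvalue (A ** transpose A) lam_min_A" and "lam_min_A > 0"
    and "is_largest_eigenvalue (transpose B ** B) lam_max_B" and "lam_max_B > 0"
    and "\<beta>\<^sub>2 > 0" and "strongly_convex_fun \<beta>\<^sub>2 g"
    and xhat: "\<And>t. t \<ge> 1 \<Longrightarrow> A *v xhat t + B *v z t = c"
    and rho: "\<And>t. t \<ge> 1 \<Longrightarrow> \<rho> t = \<beta>\<^sub>2 * real t / lam_max_B"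
    and "T \<ge> 1"
  shows "regret2 A B c Z f g xhat z T
           \<le> ereal (G\<^sub>f\<^sup>2 * lam_max_B / (2 * lam_min_A * \<beta>\<^sub>2) * ln (real T + 1) + \<beta>\<^sub>2 * D\<^sub>z\<^sup>2)
       \<and> constraint_regret A B c x z T
           \<le> lam_max_B * D\<^sub>z\<^sup>2 + 2 * F * lam_max_B / \<beta>\<^sub>2 * ln (real T + 1)"
proof -
  note convex_f = assms(2)
  have g: "convex_fun g" "closed_fun g" "\<And>w. 0 \<le> g w" "strongly_convex_fun \<beta>\<^sub>2 g"
    by fact+
  have L: "lam_max_B > 0" and \<beta>: "\<beta>\<^sub>2 > 0" and lA: "lam_min_A > 0" and F: "F > 0"
    by fact+
  have B_le: "(norm (B *v v))\<^sup>2 \<le> lam_max_B * (norm v)\<^sup>2" for v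
    by (rule norm_matrix_vector_mult_le) fact
  have A_ge: "lam_min_A * (norm v)\<^sup>2 \<le> (norm (A *v v))\<^sup>2" for v
    by (rule norm_matrix_vector_mult_ge) fact+
  have rho_pos: "\<rho> t > 0" if "t \<ge> 1" for t
    using rho[OF that] L \<beta> that by simp

  \<comment> \<open>Optimality of the iterates and finiteness of \<open>g\<close> along the
    run\<close>
  have min_x: "is_arg_min (\<lambda>u. f t u + y t \<bullet> residual A B c u (z t)
      + \<rho> (t + 1) / 2 * (norm (residual A B c u (z t)))\<^sup>2) (\<lambda>u. True) (x (t + 1))"
    and min_z: "is_arg_min (\<lambda>w. g w + ereal (y t \<bullet> residual A B c (x (t + 1)) w
      + \<rho> (t + 1) / 2 * (norm (residual A B c (x (t + 1)) w))\<^sup>2)) (\<lambda>w. w \<in> Z) (z (t + 1))"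
    and y_Suc: "y (t + 1) = y t + \<rho> (t + 1) *\<^sub>R residual A B c (x (t + 1)) (z (t + 1))"
    if "t \<ge> 1" for t
    using run that unfolding oadm_def by blast+

  have g0: "g 0 = 0" using c(3) d(1) by simp
  \<comment> \<open>Only from index 2 on is \<open>z t\<close> a minimizer; comparing it with the
    point 0 of \<open>Z\<close>, where \<open>g\<close> is 0, gives finiteness. The start is the
    point 0 itself.\<close>
  have z_fin: "z t \<in> Z \<and> g (z t) < \<infinity>" if "t \<ge> 1" for t
  proof (cases "t = 1")
    case False
    define s where "s = t - 1"
    have s: "s \<ge> 1" "t = s + 1" using that False by (auto simp: s_def)
    define q where "q = (\<lambda>w. y s \<bullet> residual A B c (x t) w
      + \<rho> t / 2 * (norm (residual A B c (x t) w))\<^sup>2)"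
    have "z t \<in> Z" "g (z t) + ereal (q (z t)) \<le> g 0 + ereal (q 0)"
      using min_z[OF s(1)] \<open>0 \<in> Z\<close> unfolding is_arg_min_linorder s(2)[symmetric] q_def by auto
    then show ?thesis
      using g0 by (cases "g (z t)") auto
  qed (use c d in auto)
  define G where "G = (\<lambda>t. real_of_ereal (g (z t)))"
  have zZ: "z t \<in> Z" and G: "g (z t) = ereal (G t)" and G_nonneg: "0 \<le> G t" if "t \<ge> 1" for t
    using z_fin[OF that] d(2)[of "z t"] unfolding G_def by (cases "g (z t)"; simp)+
  have G1: "G 1 = 0" using d(1) by (simp add: G_def)

  have z_opt: "G (t + 1) - y (t + 1) \<bullet> (B *v (w - z (t + 1))) + \<beta>\<^sub>2 / 2 * (norm (w - z (t + 1)))\<^sup>2 \<le> b"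
    if "t \<ge> 1" "w \<in> Z" "g w = ereal b" for t w b
    using z_update_first_order[OF g \<open>convex Z\<close> min_z[OF \<open>t \<ge> 1\<close>] G that(2,3)] that(1)
    unfolding y_Suc[OF that(1)] by simp

  \<comment> \<open>The per-round inequality\<close>
  define r where "r = (\<lambda>t. residual A B c (x (t + 1)) (z (t + 1)))"
  define \<delta> where "\<delta> = (\<lambda>t. B *v z (t + 1) - B *v z t)"
  \<comment> \<open>The x-update still sees the old \<open>z t\<close>, so its residual is the final
    one without the move \<open>\<delta> t\<close>.\<close>
  have res: "residual A B c (x (t + 1)) (z t) = r t - \<delta> t" for t
    by (simp add: r_def \<delta>_def residual_def)

  have monotone: "r t \<bullet> \<delta> t \<le> 0" if t: "t \<ge> 1" for t
  proof -
    \<comment> \<open>Optimality of \<open>z (t + 1)\<close> is tested at \<open>z t\<close>, then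
      that of \<open>z t\<close> at \<open>z (t + 1)\<close>. Adding both leaves the product of
      \<open>y (t + 1) - y t\<close>, which is \<open>\<rho> (t + 1)\<close> times
      \<open>r t\<close>, with \<open>\<delta> t\<close>.\<close>
    have "G (t + 1) + y (t + 1) \<bullet> \<delta> t + \<beta>\<^sub>2 / 2 * (norm (z t - z (t + 1)))\<^sup>2 \<le> G t"
      using z_opt[OF t zZ G, OF t t] by (simp add: \<delta>_def matrix_vector_mult_diff_distrib inner_diff_right)
    then have "G (t + 1) + y (t + 1) \<bullet> \<delta> t \<le> G t"
      using \<beta> by (smt (verit) mult_nonneg_nonneg zero_le_power2 half_gt_zero)
    moreover have "G t - y t \<bullet> \<delta> t \<le> G (t + 1)"
    proof (cases "t = 1")
      case True
      then show ?thesis using G1 c(2) G_nonneg[of "t + 1"] by simp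
    next
      case False
      define s where "s = t - 1"
      have s: "s \<ge> 1" "s + 1 = t" using t False by (auto simp: s_def)
      have "G t - y t \<bullet> \<delta> t + \<beta>\<^sub>2 / 2 * (norm (z (t + 1) - z t))\<^sup>2 \<le> G (t + 1)"
        using z_opt[OF s(1) zZ[of "t + 1"] G[of "t + 1"]] t unfolding s(2)
        by (simp add: \<delta>_def matrix_vector_mult_diff_distrib)
      then show ?thesis
        using \<beta> by (smt (verit) mult_nonneg_nonneg zero_le_power2 half_gt_zero)
    qed
    ultimately have "\<rho> (t + 1) * (r t \<bullet> \<delta> t) \<le> 0"
      using y_Suc[OF t] by (simp add: r_def inner_add_left)
    then show ?thesis
      using rho_pos[of "t + 1"] by (simp add: mult_le_0_iff)
  qed

  have feasible_finite: "\<exists>b. g w = ereal b" if "(u, w) \<in> feasible A B c Z" for u w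
  proof (cases "g w")
    case PInf
    \<comment> \<open>An infinite \<open>g w\<close> would make the difference in assumption (e)
      equal to minus infinity, since \<open>g (z 2)\<close> is finite.\<close>
    then show ?thesis using e(2)[OF _ that, of 1] G[of "1 + 1"] by simp
  qed (use d(2)[of w] in auto)

  have step: "f t (x (t + 1)) + G (t + 1) - (f t u + b)
      \<le> ((norm (y t))\<^sup>2 - (norm (y (t + 1)))\<^sup>2) / (2 * \<rho> (t + 1)) - \<rho> (t + 1) / 2 * (norm (r t - \<delta> t))\<^sup>2
        + \<rho> (t + 1) / 2 * ((norm (B *v (z t - w)))\<^sup>2 - (norm (B *v (z (t + 1) - w)))\<^sup>2)
        - \<beta>\<^sub>2 / 2 * (norm (z (t + 1) - w))\<^sup>2"
    if t: "t \<ge> 1" and uw: "(u, w) \<in> feasible A B c Z" and b: "g w = ereal b" for t u w b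
  proof -
    let ?e = "B *v (z t - w)"
    have w: "w \<in> Z" and Au: "A *v u = c - B *v w"
      using uw by (auto simp: feasible_def algebra_simps)
    have e': "B *v (z (t + 1) - w) = ?e + \<delta> t"
      by (simp add: \<delta>_def algebra_simps)
    have "A *v (u - x (t + 1)) = - (r t - (?e + \<delta> t))"
      by (simp add: \<delta>_def r_def residual_def Au algebra_simps)
    \<comment> \<open>The dual vector of the x-condition lags behind the new multiplier by the term
      in \<open>\<delta> t\<close>.\<close>
    moreover have "y t + \<rho> (t + 1) *\<^sub>R (r t - \<delta> t) = y (t + 1) - \<rho> (t + 1) *\<^sub>R \<delta> t"
      using y_Suc[OF t] by (simp add: r_def algebra_simps)
    ultimately have "f t (x (t + 1)) + (y (t + 1) - \<rho> (t + 1) *\<^sub>R \<delta> t) \<bullet> (r t - (?e + \<delta> t)) \<le> f t u"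
      using x_update_first_order[OF convex_f[OF t] min_x[OF t], of u] unfolding res
      by (simp only: inner_minus_right minus_minus diff_minus_eq_add)
    moreover have "B *v (w - z (t + 1)) = - (?e + \<delta> t)"
      by (simp add: \<delta>_def algebra_simps)
    then have "G (t + 1) + y (t + 1) \<bullet> (?e + \<delta> t) + \<beta>\<^sub>2 / 2 * (norm (z (t + 1) - w))\<^sup>2 \<le> b"
      using z_opt[OF t w b] by (simp add: norm_minus_commute inner_minus_right inner_add_right inner_diff_right)
    \<comment> \<open>The new multiplier cancels against \<open>?e + \<delta> t\<close>, which
      leaves the left side of \<open>oadm_step_identity\<close>.\<close>
    moreover have "(y (t + 1) - \<rho> (t + 1) *\<^sub>R \<delta> t) \<bullet> (r t - (?e + \<delta> t)) + y (t + 1) \<bullet> (?e + \<delta> t)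
        = y (t + 1) \<bullet> r t - \<rho> (t + 1) * (\<delta> t \<bullet> (r t - (?e + \<delta> t)))"
      by (simp add: inner_diff_left inner_diff_right inner_add_right right_diff_distrib distrib_left)
    ultimately have "f t (x (t + 1)) + G (t + 1) - (f t u + b)
      \<le> - (y (t + 1) \<bullet> r t) + \<rho> (t + 1) * (\<delta> t \<bullet> (r t - (?e + \<delta> t))) - \<beta>\<^sub>2 / 2 * (norm (z (t + 1) - w))\<^sup>2"
      by linarith
    moreover have "- (y (t + 1) \<bullet> r t) + \<rho> (t + 1) * (\<delta> t \<bullet> (r t - (?e + \<delta> t)))
      = ((norm (y t))\<^sup>2 - (norm (y (t + 1)))\<^sup>2) / (2 * \<rho> (t + 1)) - \<rho> (t + 1) / 2 * (norm (r t - \<delta> t))\<^sup>2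
        + \<rho> (t + 1) / 2 * ((norm ?e)\<^sup>2 - (norm (?e + \<delta> t))\<^sup>2)"
      using oadm_step_identity[of "\<rho> (t + 1)" "y t" "r t" "\<delta> t" ?e] rho_pos[of "t + 1"] y_Suc[OF t]
      by (simp add: r_def)
    ultimately show ?thesis
      unfolding e' by linarith
  qed

  \<comment> \<open>The cost of moving from \<open>x (t + 1)\<close> to
    \<open>xhat t\<close>\<close>
  have hat: "f t (xhat t) - f t (x (t + 1))
      \<le> G\<^sub>f\<^sup>2 / (2 * lam_min_A * \<rho> (t + 1)) + \<rho> (t + 1) / 2 * (norm (r t - \<delta> t))\<^sup>2"
    if t: "t \<ge> 1" for t
  proof -
    obtain s where s: "s \<in> subdifferential (\<lambda>v. ereal (f t v)) (xhat t)"
      using convex_on_subdifferential_nonempty[OF convex_f[OF t]] .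
    define h where "h = x (t + 1) - xhat t"
    have Ah: "A *v h = r t - \<delta> t"
      using xhat[OF t] unfolding h_def r_def \<delta>_def residual_def
      by (simp add: algebra_simps)
    define R where "R = \<rho> (t + 1)"
    have R: "R > 0" using rho_pos by (simp add: R_def)
    have "f t (xhat t) + s \<bullet> h \<le> f t (x (t + 1))"
      using s by (auto simp: subdifferential_def h_def)
    moreover have "- (s \<bullet> h) \<le> G\<^sub>f * norm h"
      using norm_cauchy_schwarz[of "- s" h] a[OF t s] mult_right_mono[of "norm s" "G\<^sub>f" "norm h"]
      by simp
    moreover have "G\<^sub>f * norm h \<le> G\<^sub>f\<^sup>2 / (2 * lam_min_A * R) + R / 2 * (lam_min_A * (norm h)\<^sup>2)"
    proof -
      \<comment> \<open>Young's inequality, balanced so that the quadratic part is at most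
        \<open>R / 2\<close> times the squared norm of \<open>r t - \<delta> t\<close>, the negative
        term of \<open>step\<close>.\<close>
      have "0 \<le> (G\<^sub>f - lam_min_A * R * norm h)\<^sup>2 / (2 * lam_min_A * R)"
        using lA R by simp
      also have "\<dots> = G\<^sub>f\<^sup>2 / (2 * lam_min_A * R) + R / 2 * (lam_min_A * (norm h)\<^sup>2) - G\<^sub>f * norm h"
        using lA R by (simp add: power2_eq_square field_simps)
      finally show ?thesis by simp
    qed
    moreover have "R / 2 * (lam_min_A * (norm h)\<^sup>2) \<le> R / 2 * (norm (r t - \<delta> t))\<^sup>2"
      using A_ge[of h] R by (intro mult_left_mono) (auto simp: Ah)
    ultimately show ?thesis
      unfolding R_def by linarith
  qed

  have rho_Suc: "\<rho> (t + 1) = \<beta>\<^sub>2 / lam_max_B * (real t + 1)" for t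
    using rho[of "t + 1"] by simp
  have norm_w: "(norm w)\<^sup>2 \<le> D\<^sub>z\<^sup>2" if "(u, w) \<in> feasible A B c Z" for u w
    using c(6)[OF that] c(3) by (intro power_mono) auto
  have e1: "(norm (B *v (z 1 - w)))\<^sup>2 \<le> lam_max_B * D\<^sub>z\<^sup>2" if "(u, w) \<in> feasible A B c Z" for u w
  proof -
    have "(norm (B *v (z 1 - w)))\<^sup>2 \<le> lam_max_B * (norm (z 1 - w))\<^sup>2"
      by (rule B_le)
    also have "\<dots> \<le> lam_max_B * D\<^sub>z\<^sup>2"
      using norm_w[OF that] L c(3) by simp
    finally show ?thesis .
  qed

  \<comment> \<open>The bound on the regret\<close>
  have bound2: "(\<Sum>t=1..T. f t (xhat t) + G t) - (\<Sum>t=1..T. f t u + b)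
      \<le> G\<^sub>f\<^sup>2 * lam_max_B / (2 * lam_min_A * \<beta>\<^sub>2) * ln (real T + 1) + \<beta>\<^sub>2 * D\<^sub>z\<^sup>2"
    if uw: "(u, w) \<in> feasible A B c Z" and b: "g w = ereal b" for u w b
  proof -
    define E where "E = (\<lambda>t. (norm (B *v (z t - w)))\<^sup>2)"
    define N where "N = (\<lambda>t. \<beta>\<^sub>2 / 2 * (norm (z (t + 1) - w))\<^sup>2)"
    define Y where "Y = (\<lambda>t. (norm (y t))\<^sup>2)"
    define C where "C = G\<^sub>f\<^sup>2 * lam_max_B / (2 * lam_min_A * \<beta>\<^sub>2)"
    \<comment> \<open>The regret charges \<open>G t\<close>, while \<open>step\<close> bounds
      \<open>G (t + 1)\<close>; the differences telescope to \<open>G 1 - G (T + 1)\<close>, which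
      is at most 0.\<close>
    have "(\<Sum>t=1..T. f t (xhat t) + G t) - (\<Sum>t=1..T. f t u + b)
        = (\<Sum>t=1..T. (f t (xhat t) + G (t + 1) - (f t u + b)) + (G t - G (t + 1)))"
      by (simp add: sum.distrib sum_subtractf)
    \<comment> \<open>The terms \<open>- 0\<close> bring the sums without compensation into the
      shape of \<open>sum_weighted_telescope_le\<close>.\<close>
    also have "\<dots> \<le> (\<Sum>t=1..T. C * (1 / (real t + 1)) + (1 / (2 * \<rho> (t + 1)) * (Y t - Y (t + 1)) - 0)
        + (\<rho> (t + 1) / 2 * (E t - E (t + 1)) - N t) + (1 * (G t - G (t + 1)) - 0))"
    proof (rule sum_mono)
      fix t assume "t \<in> {1..T}"
      then have t: "t \<ge> 1" by simp
      have "G\<^sub>f\<^sup>2 / (2 * lam_min_A * \<rho> (t + 1)) = C * (1 / (real t + 1))"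
        unfolding rho_Suc C_def using L \<beta> lA by (simp add: field_simps)
      then show "f t (xhat t) + G (t + 1) - (f t u + b) + (G t - G (t + 1))
        \<le> C * (1 / (real t + 1)) + (1 / (2 * \<rho> (t + 1)) * (Y t - Y (t + 1)) - 0)
          + (\<rho> (t + 1) / 2 * (E t - E (t + 1)) - N t) + (1 * (G t - G (t + 1)) - 0)"
        using step[OF t uw b] hat[OF t] unfolding E_def N_def Y_def by simp
    qed
    also have "\<dots> = C * (\<Sum>t=1..T. 1 / (real t + 1))
        + (\<Sum>t=1..T. 1 / (2 * \<rho> (t + 1)) * (Y t - Y (t + 1)) - 0)
        + (\<Sum>t=1..T. \<rho> (t + 1) / 2 * (E t - E (t + 1)) - N t)
        + (\<Sum>t=1..T. 1 * (G t - G (t + 1)) - 0)"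
      by (simp only: sum.distrib sum_distrib_left)
    also have "\<dots> \<le> C * ln (real T + 1) + 0 + \<beta>\<^sub>2 * D\<^sub>z\<^sup>2 + 0"
    proof (intro add_mono)
      show "C * (\<Sum>t=1..T. 1 / (real t + 1)) \<le> C * ln (real T + 1)"
        using sum_inverse_Suc_le_ln L lA \<beta> by (intro mult_left_mono) (auto simp: C_def)
      have "(\<Sum>t=1..T. 1 / (2 * \<rho> (t + 1)) * (Y t - Y (t + 1)) - 0)
          \<le> 1 / (2 * \<rho> (1 + 1)) * Y 1 - 1 / (2 * \<rho> (T + 1 + 1)) * Y (T + 1)"
      proof (rule sum_weighted_telescope_le)
        fix t :: nat
        have "1 / (2 * \<rho> (t + 1 + 1)) \<le> 1 / (2 * \<rho> (t + 1))"
          using L \<beta> unfolding rho_Suc by (intro divide_left_mono mult_left_mono mult_pos_pos) auto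
        then show "1 / (2 * \<rho> (t + 1 + 1)) * Y (t + 1) \<le> 1 / (2 * \<rho> (t + 1)) * Y (t + 1) + 0"
          by (simp add: mult_right_mono Y_def del: times_divide_eq_left)
      qed
      also have "\<dots> \<le> 0"
        using rho_pos[of "T + 1 + 1"] c(2) by (simp add: Y_def)
      finally show "(\<Sum>t=1..T. 1 / (2 * \<rho> (t + 1)) * (Y t - Y (t + 1)) - 0) \<le> 0" .
      have "(\<Sum>t=1..T. \<rho> (t + 1) / 2 * (E t - E (t + 1)) - N t)
          \<le> \<rho> (1 + 1) / 2 * E 1 - \<rho> (T + 1 + 1) / 2 * E (T + 1)"
      proof (rule sum_weighted_telescope_le)
        fix t :: nat
        \<comment> \<open>The factor on the left is the growth of the weight
          \<open>\<rho> (t + 1) / 2\<close> in one round.\<close>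
        have "\<beta>\<^sub>2 / (2 * lam_max_B) * E (t + 1) \<le> \<beta>\<^sub>2 / (2 * lam_max_B) * (lam_max_B * (norm (z (t + 1) - w))\<^sup>2)"
          unfolding E_def using B_le L \<beta> by (intro mult_left_mono) auto
        also have "\<dots> = N t"
          using L by (simp add: N_def)
        finally show "\<rho> (t + 1 + 1) / 2 * E (t + 1) \<le> \<rho> (t + 1) / 2 * E (t + 1) + N t"
          unfolding rho_Suc by (simp add: algebra_simps add_divide_distrib)
      qed
      also have "\<dots> \<le> \<rho> (1 + 1) / 2 * E 1"
        using rho_pos[of "T + 1 + 1"] by (simp add: E_def)
      also have "\<dots> \<le> \<rho> (1 + 1) / 2 * (lam_max_B * D\<^sub>z\<^sup>2)"
        unfolding E_def using e1[OF uw] rho_pos[of "1 + 1"] by (intro mult_left_mono) auto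
      \<comment> \<open>The first weight is
        \<open>\<rho> 2 / 2 = \<beta>\<^sub>2 / lam_max_B\<close>, which cancels
        \<open>lam_max_B\<close>.\<close>
      also have "\<dots> = \<beta>\<^sub>2 * D\<^sub>z\<^sup>2"
        using L unfolding rho_Suc by simp
      finally show "(\<Sum>t=1..T. \<rho> (t + 1) / 2 * (E t - E (t + 1)) - N t) \<le> \<beta>\<^sub>2 * D\<^sub>z\<^sup>2" .
      have "(\<Sum>t=1..T. 1 * (G t - G (t + 1)) - 0) \<le> 1 * G 1 - 1 * G (T + 1)"
        by (rule sum_weighted_telescope_le) simp
      also have "\<dots> \<le> 0"
        using G1 G_nonneg[of "T + 1"] by simp
      finally show "(\<Sum>t=1..T. 1 * (G t - G (t + 1)) - 0) \<le> 0" .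
    qed
    finally show ?thesis by (simp add: C_def)
  qed

  have "regret2 A B c Z f g xhat z T
      \<le> ereal (G\<^sub>f\<^sup>2 * lam_max_B / (2 * lam_min_A * \<beta>\<^sub>2) * ln (real T + 1) + \<beta>\<^sub>2 * D\<^sub>z\<^sup>2)"
    (is "_ \<le> ereal ?K")
  proof -
    define s where "s = (\<Sum>t=1..T. f t (xhat t) + G t)"
    define I where "I = (INF (u, w)\<in>feasible A B c Z. \<Sum>t=1..T. ereal (f t u) + g w)"
    \<comment> \<open>The infimum is reached through its lower bounds: \<open>bound2\<close> holds
      for each feasible pair separately.\<close>
    have "ereal (s - ?K) \<le> I"
      unfolding I_def
    proof (rule INF_greatest, clarify)
      fix u w assume uw: "(u, w) \<in> feasible A B c Z"
      then obtain b where b: "g w = ereal b"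
        using feasible_finite by blast
      show "ereal (s - ?K) \<le> (\<Sum>t=1..T. ereal (f t u) + g w)"
        using bound2[OF uw b] by (simp add: b s_def sum_ereal)
    qed
    moreover have "(\<Sum>t=1..T. ereal (f t (xhat t)) + g (z t)) = ereal s"
      by (simp add: s_def G flip: sum_ereal)
    ultimately show ?thesis
      unfolding regret2_def I_def[symmetric] by (cases I) auto
  qed

  \<comment> \<open>The bound on the constraint violation\<close>
  moreover have "constraint_regret A B c x z T
      \<le> lam_max_B * D\<^sub>z\<^sup>2 + 2 * F * lam_max_B / \<beta>\<^sub>2 * ln (real T + 1)"
  proof -
    \<comment> \<open>One fixed feasible pair suffices as comparator: assumption (e) bounds the left
      side of \<open>step\<close> below by \<open>- F\<close>.\<close>
    obtain u w where uw: "(u, w) \<in> feasible A B c Z"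
      using \<open>feasible A B c Z \<noteq> {}\<close> by auto
    obtain b where b: "g w = ereal b"
      using feasible_finite[OF uw] by blast
    define E where "E = (\<lambda>t. (norm (B *v (z t - w)))\<^sup>2)"
    define Y where "Y = (\<lambda>t. (norm (y t))\<^sup>2)"
    define C where "C = 2 * F * lam_max_B / \<beta>\<^sub>2"
    have "constraint_regret A B c x z T = (\<Sum>t=1..T. (norm (r t))\<^sup>2 + (norm (\<delta> t))\<^sup>2)"
      by (simp add: constraint_regret_def r_def \<delta>_def residual_def)
    also have "\<dots> \<le> (\<Sum>t=1..T. C * (1 / (real t + 1)) + (1 / (\<rho> (t + 1))\<^sup>2 * (Y t - Y (t + 1)) - 0)
        + (1 * (E t - E (t + 1)) - 0))"
    proof (rule sum_mono)
      fix t assume "t \<in> {1..T}"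
      then have t: "t \<ge> 1" by simp
      define R where "R = \<rho> (t + 1)"
      have R: "R > 0" using rho_pos by (simp add: R_def)
      have "- F \<le> f t (x (t + 1)) + G (t + 1) - (f t u + b)"
        using e(2)[OF t uw] by (simp add: G b)
      moreover have "f t (x (t + 1)) + G (t + 1) - (f t u + b)
          \<le> (Y t - Y (t + 1)) / (2 * R) - R / 2 * (norm (r t - \<delta> t))\<^sup>2 + R / 2 * (E t - E (t + 1))"
        using step[OF t uw b] \<beta> unfolding Y_def E_def R_def
        by (smt (verit) mult_nonneg_nonneg zero_le_power2 half_gt_zero)
      moreover have "(norm (r t))\<^sup>2 + (norm (\<delta> t))\<^sup>2 \<le> (norm (r t - \<delta> t))\<^sup>2"
        using monotone[OF t] unfolding power2_norm_eq_inner
        by (simp add: inner_diff_left inner_diff_right inner_commute)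
      then have "R / 2 * ((norm (r t))\<^sup>2 + (norm (\<delta> t))\<^sup>2) \<le> R / 2 * (norm (r t - \<delta> t))\<^sup>2"
        using R by (intro mult_left_mono) auto
      ultimately have "R / 2 * ((norm (r t))\<^sup>2 + (norm (\<delta> t))\<^sup>2)
          \<le> F + (Y t - Y (t + 1)) / (2 * R) + R / 2 * (E t - E (t + 1))"
        by linarith
      \<comment> \<open>Cancelling \<open>R / 2\<close> leaves the nonincreasing weight
        \<open>1 / R\<^sup>2\<close> on the multiplier terms and the constant weight 1 on the
        distance terms, so the latter telescope directly.\<close>
      also have "\<dots> = R / 2 * (2 * F / R + 1 / R\<^sup>2 * (Y t - Y (t + 1)) + (E t - E (t + 1)))"
        using R by (simp add: field_simps power2_eq_square)
      finally have "(norm (r t))\<^sup>2 + (norm (\<delta> t))\<^sup>2 \<le> 2 * F / R + 1 / R\<^sup>2 * (Y t - Y (t + 1)) + (E t - E (t + 1))"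
        using R by (simp only: mult_le_cancel_left_pos half_gt_zero)
      moreover have "2 * F / R = C * (1 / (real t + 1))"
        unfolding R_def rho_Suc C_def using L \<beta> by simp
      ultimately show "(norm (r t))\<^sup>2 + (norm (\<delta> t))\<^sup>2
        \<le> C * (1 / (real t + 1)) + (1 / (\<rho> (t + 1))\<^sup>2 * (Y t - Y (t + 1)) - 0) + (1 * (E t - E (t + 1)) - 0)"
        by (simp add: R_def)
    qed
    also have "\<dots> = C * (\<Sum>t=1..T. 1 / (real t + 1))
        + (\<Sum>t=1..T. 1 / (\<rho> (t + 1))\<^sup>2 * (Y t - Y (t + 1)) - 0)
        + (\<Sum>t=1..T. 1 * (E t - E (t + 1)) - 0)"
      by (simp only: sum.distrib sum_distrib_left)
    also have "\<dots> \<le> C * ln (real T + 1) + 0 + lam_max_B * D\<^sub>z\<^sup>2"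
    proof (intro add_mono)
      show "C * (\<Sum>t=1..T. 1 / (real t + 1)) \<le> C * ln (real T + 1)"
        using sum_inverse_Suc_le_ln L F \<beta> by (intro mult_left_mono) (auto simp: C_def)
      have "(\<Sum>t=1..T. 1 / (\<rho> (t + 1))\<^sup>2 * (Y t - Y (t + 1)) - 0)
          \<le> 1 / (\<rho> (1 + 1))\<^sup>2 * Y 1 - 1 / (\<rho> (T + 1 + 1))\<^sup>2 * Y (T + 1)"
      proof (rule sum_weighted_telescope_le)
        fix t :: nat
        have "\<rho> (t + 1) \<le> \<rho> (t + 1 + 1)" 
          using L \<beta> unfolding rho_Suc by (intro mult_left_mono) auto
        then have "1 / (\<rho> (t + 1 + 1))\<^sup>2 \<le> 1 / (\<rho> (t + 1))\<^sup>2"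
          using rho_pos[of "t + 1"] by (intro divide_left_mono power_mono mult_pos_pos) auto
        then show "1 / (\<rho> (t + 1 + 1))\<^sup>2 * Y (t + 1) \<le> 1 / (\<rho> (t + 1))\<^sup>2 * Y (t + 1) + 0"
          by (simp add: mult_right_mono Y_def del: times_divide_eq_left)
      qed
      also have "\<dots> \<le> 0"
        using c(2) by (simp add: Y_def)
      finally show "(\<Sum>t=1..T. 1 / (\<rho> (t + 1))\<^sup>2 * (Y t - Y (t + 1)) - 0) \<le> 0" .
      have "(\<Sum>t=1..T. 1 * (E t - E (t + 1)) - 0) \<le> 1 * E 1 - 1 * E (T + 1)"
        by (rule sum_weighted_telescope_le) simp
      also have "\<dots> \<le> lam_max_B * D\<^sub>z\<^sup>2"
        using e1[OF uw] unfolding E_def by (smt (verit) zero_le_power2)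
      finally show "(\<Sum>t=1..T. 1 * (E t - E (t + 1)) - 0) \<le> lam_max_B * D\<^sub>z\<^sup>2" .
    qed
    finally show ?thesis by (simp add: C_def)
  qed
  ultimately show ?thesis by blast
qed

end
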